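(* Let $p_A,p_B\in[0,1]$. If it is neither the case that $p_A=p_B=0$ nor that $p_A=p_B=1$, then the set tie-breaker's tie-breaker ends (after finitely many points) with probability one: $\theta_{STT}^{END}(p_A,p_B)=1$. Furthermore, the result still holds if the serving sequence is changed by permuting the two servers within any of the adjacent odd/even pairs of points (e.g., $ABBA$ into $BABA$).
   Context: Players $A$ and $B$ play points; all point outcomes are independent. When $A$ serves a point, $A$ wins it with probability $p_A$ (and $B$ wins it otherwise); when $B$ serves a point, $B$ wins it with probability $p_B$ (and $A$ wins it otherwise). Set tie-breaker's tie-breaker (STT): starting from an even score, points are played with serving sequence $ABBAABBAA\ldots$ ($A$ serves points 1, 4, 5, 8, 9, $\ldots$; $B$ serves the others), until one player is ahead by two points for the first time; that player wins and the STT ends. An odd/even pair of points consists of the points numbered $2m-1$ and $2m$, $m\ge 1$; in the serving sequence each player serves exactly one point in each such pair, and "permuting" means interchanging, in any chosen collection of these pairs, which of the two points is served by $A$ and which by $B$. $\theta_{STT}^{END}(p_A,p_B)$ is the probability that the STT ends after finitely many points. *)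

theory Defs
  imports "HOL-Probability.Probability"
begin

datatype player = Player_A | Player_B

text \<open>Points are numbered from 1. A serving sequence is a function
  \<open>nat \<Rightarrow> player\<close> whose value at 0 is irrelevant.\<close>

definition stt_server :: "nat \<Rightarrow> player" where
  "stt_server n = (if n mod 4 \<in> {0, 1} then Player_A else Player_B)"

text \<open>Pair \<open>m \<ge> 1\<close> consists of the points \<open>2 * m - 1\<close> and \<open>2 * m\<close>, so point \<open>n\<close>
  lies in pair \<open>(n + 1) div 2\<close>.\<close>

definition pair_partner :: "nat \<Rightarrow> nat" where
  "pair_partner n = (if odd n then n + 1 else n - 1)"

definition permute_pairs :: "nat set \<Rightarrow> (nat \<Rightarrow> player) \<Rightarrow> nat \<Rightarrow> player" where
  "permute_pairs S srv n = (if (n + 1) div 2 \<in> S then srv (pair_partner n) else srv n)"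

definition point_winner_pmf :: "real \<Rightarrow> real \<Rightarrow> player \<Rightarrow> player pmf" where
  "point_winner_pmf pA pB s =
     (case s of
        Player_A \<Rightarrow> map_pmf (\<lambda>w. if w then Player_A else Player_B) (bernoulli_pmf pA)
      | Player_B \<Rightarrow> map_pmf (\<lambda>w. if w then Player_B else Player_A) (bernoulli_pmf pB))"

text \<open>The probability space carries the winners of all points 1, 2, ...; play is continued
  formally after the tie-breaker has ended, which does not affect whether it ends.\<close>

definition points_measure :: "(nat \<Rightarrow> player) \<Rightarrow> real \<Rightarrow> real \<Rightarrow> (nat \<Rightarrow> player) measure" where
  "points_measure srv pA pB =
     (\<Pi>\<^sub>M n\<in>{1..}. measure_pmf (point_winner_pmf pA pB (srv n)))"

definition points_won :: "(nat \<Rightarrow> player) \<Rightarrow> player \<Rightarrow> nat \<Rightarrow> nat" where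
  "points_won w P n = card {i \<in> {1..n}. w i = P}"

definition lead :: "(nat \<Rightarrow> player) \<Rightarrow> nat \<Rightarrow> int" where
  "lead w n = int (points_won w Player_A n) - int (points_won w Player_B n)"

definition stt_ends_at :: "(nat \<Rightarrow> player) \<Rightarrow> nat \<Rightarrow> bool" where
  "stt_ends_at w n \<longleftrightarrow> \<bar>lead w n\<bar> = 2 \<and> (\<forall>m<n. \<bar>lead w m\<bar> \<noteq> 2)"

definition theta_END :: "(nat \<Rightarrow> player) \<Rightarrow> real \<Rightarrow> real \<Rightarrow> real" where
  "theta_END srv pA pB =
     measure (points_measure srv pA pB)
       {w \<in> space (points_measure srv pA pB). \<exists>n. stt_ends_at w n}"

definition theta_STT_END :: "real \<Rightarrow> real \<Rightarrow> real" where
  "theta_STT_END pA pB = theta_END stt_server pA pB"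

end

theory Submission
  imports Defs
begin

text \<open>
  Group the points into the pairs \<open>2 m + 1, 2 m + 2\<close> with \<open>m \<ge> 0\<close>. As long as the players split
  every pair, the score is level after each pair and differs by one in the middle of a pair; the
  first pair taken by a single player ends the tie-breaker. Hence it goes on forever exactly
  when every pair is split (\<open>stt_ends_iff_unsplit_pair\<close>).

  If each player serves once in a pair, then whatever the order of the two serves, the pair is
  split with probability \<open>q = p\<^sub>A p\<^sub>B + (1 - p\<^sub>A) (1 - p\<^sub>B)\<close>: either both servers win
  their points or both lose them. Different pairs are independent, so the first \<open>k\<close> pairs are all
  split with probability \<open>q ^ k\<close> (\<open>prob_first_pairs_split\<close>). Since
  \<open>1 - q = p\<^sub>A (1 - p\<^sub>B) + p\<^sub>B (1 - p\<^sub>A)\<close>, the two excluded cases are precisely those in which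
  \<open>q = 1\<close>; in all others \<open>q ^ k\<close> tends to 0. Only the presence of one serve per player in each pair
  matters, which is why permuting the servers within pairs changes nothing.
\<close>

section \<open>Termination and split pairs\<close>

lemma points_won_Suc:
  "points_won w P (Suc n) = points_won w P n + of_bool (w (Suc n) = P)"
proof -
  have "{i \<in> {1..Suc n}. w i = P} =
      (if w (Suc n) = P then insert (Suc n) {i \<in> {1..n}. w i = P} else {i \<in> {1..n}. w i = P})"
    by (auto simp: le_Suc_eq)
  then show ?thesis
    by (simp add: points_won_def)
qed

lemma lead_0: "lead w 0 = 0"
  by (simp add: lead_def points_won_def)

lemma lead_Suc: "lead w (Suc n) = lead w n + (if w (Suc n) = Player_A then 1 else - 1)"
  by (cases "w (Suc n)") (simp_all add: lead_def points_won_Suc)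

lemma player_neq_iff: "a \<noteq> Player_A \<longleftrightarrow> a = Player_B"
  by (cases a) auto

lemma lead_even_if_split:
  assumes "\<And>m. m < k \<Longrightarrow> w (2 * m + 1) \<noteq> w (2 * m + 2)"
  shows "lead w (2 * k) = 0"
  using assms
proof (induction k)
  case 0
  then show ?case by (simp add: lead_0)
next
  case (Suc k)
  have "lead w (2 * k) = 0"
    by (rule Suc.IH) (use Suc.prems in simp)
  moreover have "w (Suc (2 * k)) \<noteq> w (Suc (Suc (2 * k)))"
    using Suc.prems[of k] by simp
  ultimately show ?case
    by (cases "w (Suc (2 * k))"; cases "w (Suc (Suc (2 * k)))") (simp_all add: lead_Suc)
qed

lemma ex_stt_ends_at_iff: "(\<exists>n. stt_ends_at w n) \<longleftrightarrow> (\<exists>n. \<bar>lead w n\<bar> = 2)"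
  unfolding stt_ends_at_def using exists_least_iff[of "\<lambda>n. \<bar>lead w n\<bar> = 2"] by auto

text \<open>The first pair that is not split starts from a level score, so it produces a lead of two.\<close>

lemma stt_ends_iff_unsplit_pair:
  "(\<exists>n. stt_ends_at w n) \<longleftrightarrow> (\<exists>m. w (2 * m + 1) = w (2 * m + 2))"
proof -
  have "\<exists>m. w (2 * m + 1) = w (2 * m + 2)" if "\<bar>lead w n\<bar> = 2" for n
  proof (rule ccontr)
    assume "\<not> ?thesis"
    then have level: "lead w (2 * k) = 0" for k
      by (intro lead_even_if_split) auto
    have "n = 2 * (n div 2) \<or> n = Suc (2 * (n div 2))"
      by presburger
    then have "\<bar>lead w n\<bar> \<le> 1"
    proof
      assume "n = 2 * (n div 2)"
      with level[of "n div 2"] show ?thesis by simp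
    next
      assume "n = Suc (2 * (n div 2))"
      then have "lead w n = lead w (Suc (2 * (n div 2)))"
        by (rule arg_cong)
      then show ?thesis
        by (simp only: lead_Suc level) simp
    qed
    with that show False by simp
  qed
  moreover have "\<exists>n. \<bar>lead w n\<bar> = 2" if unsplit: "\<exists>m. w (2 * m + 1) = w (2 * m + 2)"
  proof -
    obtain m where m: "w (2 * m + 1) = w (2 * m + 2)"
      and min: "\<And>i. i < m \<Longrightarrow> w (2 * i + 1) \<noteq> w (2 * i + 2)"
      using unsplit exists_least_iff[of "\<lambda>m. w (2 * m + 1) = w (2 * m + 2)"] by auto
    have "lead w (2 * m) = 0"
      using min by (rule lead_even_if_split)
    then have "\<bar>lead w (Suc (Suc (2 * m)))\<bar> = 2"
      using m by (simp add: lead_Suc)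
    then show ?thesis ..
  qed
  ultimately show ?thesis
    by (auto simp: ex_stt_ends_at_iff)
qed

section \<open>Independence of the pairs\<close>

lemma product_prob_space_points:
  "product_prob_space (\<lambda>n. measure_pmf (point_winner_pmf pA pB (srv n)))"
  by unfold_locales

lemma prob_space_points: "prob_space (points_measure srv pA pB)"
  unfolding points_measure_def by (intro prob_space_PiM prob_space_measure_pmf)

lemma measurable_point:
  "n \<ge> 1 \<Longrightarrow> (\<lambda>w. w n) \<in> measurable (points_measure srv pA pB) (count_space UNIV)"
  unfolding points_measure_def
  using measurable_component_singleton[of n "{1..}" "\<lambda>n. measure_pmf (point_winner_pmf pA pB (srv n))"]
  by (simp cong: measurable_cong_sets)

text \<open>A family is independent iff its joint law is the product of its marginals; for the
  coordinates of a product measure, both sides are that product measure itself.\<close>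

lemma indep_points:
  "prob_space.indep_vars (points_measure srv pA pB)
     (\<lambda>n. measure_pmf (point_winner_pmf pA pB (srv n))) (\<lambda>n w. w n) {1..}"
proof -
  interpret prob_space "points_measure srv pA pB"
    by (rule prob_space_points)
  let ?M = "\<lambda>n. measure_pmf (point_winner_pmf pA pB (srv n))"
  have "distr (points_measure srv pA pB) (PiM {1..} ?M) (\<lambda>w. restrict w {1..}) = PiM {1..} ?M"
    unfolding points_measure_def
    by (subst distr_cong[OF refl refl, where g = "\<lambda>w. w"])
      (auto simp: space_PiM intro!: distr_id)
  also have "\<dots> = PiM {1..} (\<lambda>n. distr (points_measure srv pA pB) (?M n) (\<lambda>w. w n))"
    unfolding points_measure_def
    by (intro PiM_cong refl distr_PiM_component[symmetric] prob_space_measure_pmf)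
  finally show ?thesis
    by (subst indep_vars_iff_distr_eq_PiM')
      (auto simp: measurable_point cong: measurable_cong_sets)
qed

lemma pmf_point_winner:
  assumes "pA \<in> {0..1}" "pB \<in> {0..1}"
  shows "pmf (point_winner_pmf pA pB Player_A) Player_A = pA"
    and "pmf (point_winner_pmf pA pB Player_A) Player_B = 1 - pA"
    and "pmf (point_winner_pmf pA pB Player_B) Player_A = 1 - pB"
    and "pmf (point_winner_pmf pA pB Player_B) Player_B = pB"
proof -
  have *: "inj (\<lambda>w. if w then a else b)" if "a \<noteq> b" for a b :: player
    using that by (auto simp: inj_def)
  show "pmf (point_winner_pmf pA pB Player_A) Player_A = pA"
    and "pmf (point_winner_pmf pA pB Player_A) Player_B = 1 - pA"
    and "pmf (point_winner_pmf pA pB Player_B) Player_A = 1 - pB"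
    and "pmf (point_winner_pmf pA pB Player_B) Player_B = pB"
    using pmf_map_inj'[OF *[of Player_A Player_B], of "bernoulli_pmf pA" True]
      pmf_map_inj'[OF *[of Player_A Player_B], of "bernoulli_pmf pA" False]
      pmf_map_inj'[OF *[of Player_B Player_A], of "bernoulli_pmf pB" True]
      pmf_map_inj'[OF *[of Player_B Player_A], of "bernoulli_pmf pB" False] assms
    by (simp_all add: point_winner_pmf_def)
qed

lemma prob_two_points:
  assumes "1 \<le> i" "1 \<le> j" "i \<noteq> j"
  shows "measure (points_measure srv pA pB) {w \<in> space (points_measure srv pA pB). w i = a \<and> w j = b} =
    pmf (point_winner_pmf pA pB (srv i)) a * pmf (point_winner_pmf pA pB (srv j)) b"
proof -
  interpret product_prob_space "\<lambda>n. measure_pmf (point_winner_pmf pA pB (srv n))" "{1..}"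
    by (rule product_prob_space_points)
  let ?X = "\<lambda>n. if n = i then {a} else {b}"
  have "{w \<in> space (points_measure srv pA pB). w i = a \<and> w j = b} = emb {1..} {i, j} (Pi\<^sub>E {i, j} ?X)"
    using assms unfolding points_measure_def prod_emb_def by (auto simp: space_PiM Pi_iff)
  then show ?thesis
    using measure_PiM_emb[of "{i, j}" ?X] assms
    by (simp add: points_measure_def pmf.rep_eq)
qed

lemma sets_split_pair:
  assumes "1 \<le> i" "1 \<le> j"
  shows "{w \<in> space (points_measure srv pA pB). w i \<noteq> w j} \<in> sets (points_measure srv pA pB)"
proof -
  have [measurable]: "(\<lambda>w. w i) \<in> measurable (points_measure srv pA pB) (count_space UNIV)"
    "(\<lambda>w. w j) \<in> measurable (points_measure srv pA pB) (count_space UNIV)"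
    using assms by (auto intro: measurable_point)
  have "{w \<in> space (points_measure srv pA pB). w i \<noteq> w j} =
    {w \<in> space (points_measure srv pA pB). w i = Player_A \<and> w j = Player_B \<or> w i = Player_B \<and> w j = Player_A}"
    by (metis player_neq_iff)
  also have "\<dots> \<in> sets (points_measure srv pA pB)"
    by measurable
  finally show ?thesis .
qed

text \<open>Both servers win or both servers lose; this is symmetric in the order of the two serves.\<close>

lemma prob_split_pair:
  assumes "pA \<in> {0..1}" "pB \<in> {0..1}" "1 \<le> i" "1 \<le> j" "srv i \<noteq> srv j"
  shows "measure (points_measure srv pA pB) {w \<in> space (points_measure srv pA pB). w i \<noteq> w j} =
    pA * pB + (1 - pA) * (1 - pB)"
proof -
  interpret prob_space "points_measure srv pA pB"
    by (rule prob_space_points)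
  let ?E = "\<lambda>a b. {w \<in> space (points_measure srv pA pB). w i = a \<and> w j = b}"
  have [measurable]: "(\<lambda>w. w i) \<in> measurable (points_measure srv pA pB) (count_space UNIV)"
    "(\<lambda>w. w j) \<in> measurable (points_measure srv pA pB) (count_space UNIV)"
    using assms by (auto intro: measurable_point)
  have "{w \<in> space (points_measure srv pA pB). w i \<noteq> w j} =
      ?E Player_A Player_B \<union> ?E Player_B Player_A"
    by (auto simp: player_neq_iff) (metis player_neq_iff)+
  moreover have "measure (points_measure srv pA pB) (?E Player_A Player_B \<union> ?E Player_B Player_A) =
      measure (points_measure srv pA pB) (?E Player_A Player_B) +
      measure (points_measure srv pA pB) (?E Player_B Player_A)"
    by (rule finite_measure_Union) (measurable, auto)
  moreover have "i \<noteq> j"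
    using assms by auto
  ultimately show ?thesis
    using assms pmf_point_winner[of pA pB]
    by (cases "srv i"; cases "srv j") (simp_all add: prob_two_points)
qed

text \<open>Disjoint blocks of independent coordinates are independent, and whether a pair is split
  depends only on its own block.\<close>

lemma prob_first_pairs_split:
  assumes "pA \<in> {0..1}" "pB \<in> {0..1}"
    and alternating: "\<And>m. srv (2 * m + 1) \<noteq> srv (2 * m + 2)"
  shows "measure (points_measure srv pA pB)
      {w \<in> space (points_measure srv pA pB). \<forall>m<k. w (2 * m + 1) \<noteq> w (2 * m + 2)} =
    (pA * pB + (1 - pA) * (1 - pB)) ^ k"
proof (cases "k = 0")
  case True
  then show ?thesis
    using prob_space.prob_space[OF prob_space_points[of srv pA pB]] by simp
next
  case False
  interpret prob_space "points_measure srv pA pB"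
    by (rule prob_space_points)
  let ?P = "points_measure srv pA pB"
  let ?M = "\<lambda>n. measure_pmf (point_winner_pmf pA pB (srv n))"
  define K where "K m = {2 * m + 1, 2 * m + 2}" for m :: nat
  define S where "S m = {w \<in> space (PiM (K m) ?M). w (2 * m + 1) \<noteq> w (2 * m + 2)}" for m
  have disj: "disjoint_family_on K {..<k}"
    unfolding disjoint_family_on_def K_def by (auto; presburger)
  have indep: "indep_vars (\<lambda>m. PiM (K m) ?M) (\<lambda>m w. restrict w (K m)) {..<k}"
    using indep_vars_restrict[OF indep_points _ disj] by (auto simp: K_def)
  have S: "S m \<in> sets (PiM (K m) ?M)" for m
  proof -
    have comp: "(\<lambda>w. w n) \<in> measurable (PiM (K m) ?M) (count_space UNIV)" if "n \<in> K m" for n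
      using measurable_component_singleton[of n "K m" ?M] that by (simp cong: measurable_cong_sets)
    have [measurable]: "(\<lambda>w. w (2 * m + 1)) \<in> measurable (PiM (K m) ?M) (count_space UNIV)"
      "(\<lambda>w. w (2 * m + 2)) \<in> measurable (PiM (K m) ?M) (count_space UNIV)"
      by (intro comp; simp add: K_def)+
    have "S m = {w \<in> space (PiM (K m) ?M). w (2 * m + 1) = Player_A \<and> w (2 * m + 2) = Player_B
        \<or> w (2 * m + 1) = Player_B \<and> w (2 * m + 2) = Player_A}"
      unfolding S_def by (metis player_neq_iff)
    also have "\<dots> \<in> sets (PiM (K m) ?M)"
      by measurable
    finally show ?thesis .
  qed
  have vimage: "(\<lambda>w. restrict w (K m)) -` S m \<inter> space ?P =
      {w \<in> space ?P. w (2 * m + 1) \<noteq> w (2 * m + 2)}" for m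
    by (auto simp: S_def K_def space_PiM)
  have "{w \<in> space ?P. \<forall>m<k. w (2 * m + 1) \<noteq> w (2 * m + 2)} =
      (\<Inter>m\<in>{..<k}. {w \<in> space ?P. w (2 * m + 1) \<noteq> w (2 * m + 2)})"
    using False by auto
  also have "prob \<dots> = (\<Prod>m<k. prob {w \<in> space ?P. w (2 * m + 1) \<noteq> w (2 * m + 2)})"
    using indep_varsD_finite[OF indep, of S] False S unfolding vimage by auto
  also have "\<dots> = (\<Prod>m<k. pA * pB + (1 - pA) * (1 - pB))"
    by (intro prod.cong refl prob_split_pair assms) simp_all
  also have "\<dots> = (pA * pB + (1 - pA) * (1 - pB)) ^ k"
    by simp
  finally show ?thesis .
qed

section \<open>Termination with probability one\<close>

text \<open>Infinite play has probability at most \<open>q ^ k\<close> for every \<open>k\<close>. The serving sequence is kept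
  general so that the original order and all its permutations within pairs are instances.\<close>

lemma theta_END_eq_1:
  assumes p: "pA \<in> {0..1}" "pB \<in> {0..1}"
    and "\<not> (pA = 0 \<and> pB = 0)" "\<not> (pA = 1 \<and> pB = 1)"
    and alternating: "\<And>m. srv (2 * m + 1) \<noteq> srv (2 * m + 2)"
  shows "theta_END srv pA pB = 1"
proof -
  interpret prob_space "points_measure srv pA pB"
    by (rule prob_space_points)
  let ?P = "points_measure srv pA pB"
  define q where "q = pA * pB + (1 - pA) * (1 - pB)"
  let ?split = "\<lambda>m. {w \<in> space ?P. w (2 * m + 1) \<noteq> w (2 * m + 2)}"
  let ?N = "{w \<in> space ?P. \<forall>m. w (2 * m + 1) \<noteq> w (2 * m + 2)}"
  have q_compl: "1 - q = pA * (1 - pB) + pB * (1 - pA)"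
    by (simp add: q_def algebra_simps)
  have "0 \<le> pA * (1 - pB)" "0 \<le> pB * (1 - pA)"
    using p by auto
  moreover have "pA * (1 - pB) \<noteq> 0 \<or> pB * (1 - pA) \<noteq> 0"
    using assms(3,4) by auto
  ultimately have "q < 1"
    using q_compl by linarith
  moreover have "0 \<le> q"
    using p by (simp add: q_def)
  ultimately have lim: "(\<lambda>k. q ^ k) \<longlonglongrightarrow> 0"
    by (intro LIMSEQ_power_zero) simp
  have sets_split: "?split m \<in> events" for m
    by (rule sets_split_pair) auto
  have "prob ?N \<le> q ^ k" for k
  proof -
    have "{w \<in> space ?P. \<forall>m\<in>{..<k}. w (2 * m + 1) \<noteq> w (2 * m + 2)} \<in> events"
      using sets_split by (rule sets.sets_Collect_countable_Ball)
    then have "{w \<in> space ?P. \<forall>m<k. w (2 * m + 1) \<noteq> w (2 * m + 2)} \<in> events"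
      by (simp only: Ball_def lessThan_iff)
    then have "prob ?N \<le> prob {w \<in> space ?P. \<forall>m<k. w (2 * m + 1) \<noteq> w (2 * m + 2)}"
      by (rule finite_measure_mono[rotated]) blast
    also have "\<dots> = q ^ k"
      unfolding q_def using p alternating by (rule prob_first_pairs_split)
    finally show ?thesis .
  qed
  then have "prob ?N \<le> 0"
    by (intro LIMSEQ_le_const[OF lim]) blast
  then have "prob ?N = 0"
    by (simp add: measure_le_0_iff)
  moreover have "?N \<in> events"
    using sets_split by (rule sets.sets_Collect_countable_All)
  moreover have "{w \<in> space ?P. \<exists>n. stt_ends_at w n} = space ?P - ?N"
    unfolding stt_ends_iff_unsplit_pair by blast
  ultimately show ?thesis
    by (simp add: theta_END_def prob_compl)
qed

lemma stt_server_alternating: "stt_server (2 * m + 1) \<noteq> stt_server (2 * m + 2)"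
proof -
  have "m mod 2 = 0 \<and> (2 * m + 1) mod 4 = 1 \<and> (2 * m + 2) mod 4 = 2 \<or>
      m mod 2 = 1 \<and> (2 * m + 1) mod 4 = 3 \<and> (2 * m + 2) mod 4 = 0"
    by presburger
  then show ?thesis
    by (auto simp: stt_server_def)
qed

lemma permute_pairs_alternating:
  assumes "\<And>m. srv (2 * m + 1) \<noteq> srv (2 * m + 2)"
  shows "permute_pairs S srv (2 * m + 1) \<noteq> permute_pairs S srv (2 * m + 2)"
proof -
  have "(2 * m + 1 + 1) div 2 = m + 1" "(2 * m + 2 + 1) div 2 = m + 1"
    by presburger+
  moreover have "pair_partner (2 * m + 1) = 2 * m + 2" "pair_partner (2 * m + 2) = 2 * m + 1"
    by (simp_all add: pair_partner_def)
  ultimately show ?thesis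
    using assms[of m] unfolding permute_pairs_def by metis
qed

theorem proposition3p1:
  fixes pA pB :: real
  assumes "pA \<in> {0..1}" and "pB \<in> {0..1}"
    and "\<not> (pA = 0 \<and> pB = 0)" and "\<not> (pA = 1 \<and> pB = 1)"
  shows "theta_STT_END pA pB = 1 \<and>
         (\<forall>S \<subseteq> {1..}. theta_END (permute_pairs S stt_server) pA pB = 1)"
  unfolding theta_STT_END_def
  by (intro conjI allI impI theta_END_eq_1 assms stt_server_alternating permute_pairs_alternating)

end
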